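(* Let $m,n\ge 1$ and let $z=(x^{k,l}_{i,j})$ be a vertex of the polytope $SATP(m,n)$. Then the coordinates of $z$ are determined by vectors $\mathbf{row}(z)\in\{0,1\}^m$ and $\mathbf{col}(z)\in\{0,1,2\}^n$ by the following formulas, valid for all $i\in\{1,\dots,m\}$ and $j\in\{1,\dots,n\}$: $$x^{1,1}_{i,j}=\tfrac12(1-\mathbf{row}_i(z))(2-\mathbf{col}_j(z))(1-\mathbf{col}_j(z)),$$ $$x^{1,2}_{i,j}=\tfrac12\,\mathbf{row}_i(z)(2-\mathbf{col}_j(z))(1-\mathbf{col}_j(z)),$$ $$x^{2,1}_{i,j}=(1-\mathbf{row}_i(z))\,\mathbf{col}_j(z)(2-\mathbf{col}_j(z)),$$ $$x^{2,2}_{i,j}=\mathbf{row}_i(z)\,\mathbf{col}_j(z)(2-\mathbf{col}_j(z)),$$ $$x^{3,1}_{i,j}=\tfrac12(1-\mathbf{row}_i(z))\,\mathbf{col}_j(z)(\mathbf{col}_j(z)-1),$$ $$x^{3,2}_{i,j}=\tfrac12\,\mathbf{row}_i(z)\,\mathbf{col}_j(z)(\mathbf{col}_j(z)-1).$$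
   Context: For positive integers $m,n$, points of $\mathbb{R}^{6mn}$ have coordinates $x^{k,l}_{i,j}$ with $k\in\{1,2,3\}$, $l\in\{1,2\}$, $i\in\{1,\dots,m\}$, $j\in\{1,\dots,n\}$. $SATP(m,n)$ is the convex hull of all integral solutions of the system $$\sum_{k,l}x^{k,l}_{i,j}=1,\qquad x^{1,1}_{i,j}+x^{2,1}_{i,j}+x^{3,1}_{i,j}=x^{1,1}_{i,t}+x^{2,1}_{i,t}+x^{3,1}_{i,t},\qquad x^{k,1}_{i,j}+x^{k,2}_{i,j}=x^{k,1}_{s,j}+x^{k,2}_{s,j},\qquad x^{k,l}_{i,j}\ge 0,$$ for all $k\in\{1,2,3\}$, $l\in\{1,2\}$, $i,s\in\{1,\dots,m\}$, $j,t\in\{1,\dots,n\}$. The vectors $\mathbf{row}(z)$ and $\mathbf{col}(z)$ are defined for a vertex $z$ by: $\mathbf{row}_i(z)=0$ if $x^{1,1}_{i,1}+x^{2,1}_{i,1}+x^{3,1}_{i,1}=1$ and $\mathbf{row}_i(z)=1$ otherwise; $\mathbf{col}_j(z)=0$ if $x^{1,1}_{1,j}+x^{1,2}_{1,j}=1$, $\mathbf{col}_j(z)=1$ if $x^{2,1}_{1,j}+x^{2,2}_{1,j}=1$, and $\mathbf{col}_j(z)=2$ otherwise. *)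

theory Defs
  imports "HOL-Analysis.Analysis"
begin

text \<open>
  The index sets $\{1,\dots,m\}$ and $\{1,\dots,n\}$ are arbitrary finite linearly ordered types
  \<open>'m\<close> and \<open>'n\<close> (nonempty, so $m, n \ge 1$), and the coordinate $x^{k,l}_{i,j}$ of a point
  \<open>x\<close> is \<open>x $ k $ l $ i $ j\<close>. The order only serves to name the index 1. The numeral type
  \<open>3\<close> has exactly the elements 1, 2, 3, where \<open>3 = 0\<close>; likewise for \<open>2\<close>.
\<close>

definition first_index :: "'i::{finite,linorder}" where
  "first_index = Min UNIV"

definition satp_system :: "real^'n^'m^2^3 \<Rightarrow> bool" where
  "satp_system x \<longleftrightarrow>
    (\<forall>i j. (\<Sum>k\<in>UNIV. \<Sum>l\<in>UNIV. x $ k $ l $ i $ j) = 1) \<and>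
    (\<forall>i j t. x $ 1 $ 1 $ i $ j + x $ 2 $ 1 $ i $ j + x $ 3 $ 1 $ i $ j =
             x $ 1 $ 1 $ i $ t + x $ 2 $ 1 $ i $ t + x $ 3 $ 1 $ i $ t) \<and>
    (\<forall>k i s j. x $ k $ 1 $ i $ j + x $ k $ 2 $ i $ j = x $ k $ 1 $ s $ j + x $ k $ 2 $ s $ j) \<and>
    (\<forall>k l i j. 0 \<le> x $ k $ l $ i $ j)"

definition SATP :: "(real^'n^'m^2^3) set" where
  "SATP = convex hull {x. satp_system x \<and> (\<forall>k l i j. x $ k $ l $ i $ j \<in> \<int>)}"

definition row_vec :: "real^('n::{finite,linorder})^'m^2^3 \<Rightarrow> real^'m" where
  "row_vec z = (\<chi> i.
     if z $ 1 $ 1 $ i $ first_index + z $ 2 $ 1 $ i $ first_index + z $ 3 $ 1 $ i $ first_index = 1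
     then 0 else 1)"

definition col_vec :: "real^'n^('m::{finite,linorder})^2^3 \<Rightarrow> real^'n" where
  "col_vec z = (\<chi> j.
     if z $ 1 $ 1 $ first_index $ j + z $ 1 $ 2 $ first_index $ j = 1 then 0
     else if z $ 2 $ 1 $ first_index $ j + z $ 2 $ 2 $ first_index $ j = 1 then 1
     else 2)"

end

theory Submission imports Defs begin

text \<open>An extreme point of a convex hull lies in the generating set, so \<open>z\<close> is itself an integral
  solution. For fixed \<open>i\<close>, \<open>j\<close> its six coordinates are then nonnegative integers with sum 1, so
  exactly one of them is 1. The row and column equations let the position of this 1 be read off
  at \<open>(i, 1)\<close> and \<open>(1, j)\<close>.\<close>

lemma Ints_unit_interval_cases:
  fixes a :: real
  assumes "a \<in> \<int>" "0 \<le> a" "a \<le> 1"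
  shows "a = 0 \<or> a = 1"
  using assms by (auto elim!: Ints_cases)

lemma SATP_extreme_point_integral:
  assumes "z extreme_point_of SATP"
  shows "satp_system z" "z $ k $ l $ i $ j \<in> \<int>"
  using extreme_point_of_convex_hull[OF assms[unfolded SATP_def]] by simp_all

theorem lemma10:
  fixes z :: "real^('n::{finite,linorder})^('m::{finite,linorder})^2^3"
  assumes "z extreme_point_of SATP"
  shows "(\<forall>i. row_vec z $ i \<in> {0, 1}) \<and>
    (\<forall>j. col_vec z $ j \<in> {0, 1, 2}) \<and>
    (\<forall>i j.
      z $ 1 $ 1 $ i $ j = 1/2 * (1 - row_vec z $ i) * (2 - col_vec z $ j) * (1 - col_vec z $ j) \<and>
      z $ 1 $ 2 $ i $ j = 1/2 * row_vec z $ i * (2 - col_vec z $ j) * (1 - col_vec z $ j) \<and>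
      z $ 2 $ 1 $ i $ j = (1 - row_vec z $ i) * col_vec z $ j * (2 - col_vec z $ j) \<and>
      z $ 2 $ 2 $ i $ j = row_vec z $ i * col_vec z $ j * (2 - col_vec z $ j) \<and>
      z $ 3 $ 1 $ i $ j = 1/2 * (1 - row_vec z $ i) * col_vec z $ j * (col_vec z $ j - 1) \<and>
      z $ 3 $ 2 $ i $ j = 1/2 * row_vec z $ i * col_vec z $ j * (col_vec z $ j - 1))"
proof -
  define x where "x k l i j = z $ k $ l $ i $ j" for k l i j
  note sys = SATP_extreme_point_integral(1)[OF assms, unfolded satp_system_def, folded x_def]
  have int: "x k l i j \<in> \<int>" for k l i j
    unfolding x_def by (rule SATP_extreme_point_integral(2)[OF assms])
  have nonneg: "0 \<le> x k l i j" for k l i j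
    using sys by blast
  have sum: "x 1 1 i j + x 1 2 i j + x 2 1 i j + x 2 2 i j + x 3 1 i j + x 3 2 i j = 1" for i j
  proof -
    have "(\<Sum>k\<in>UNIV. \<Sum>l\<in>UNIV. x k l i j) = 1"
      using sys by blast
    then show ?thesis
      by (simp add: sum_3 sum_2 add.assoc)
  qed
  have zero_one: "x k l i j = 0 \<or> x k l i j = 1" for k l i j
  proof (rule Ints_unit_interval_cases[OF int nonneg])
    \<comment> \<open>Six nonnegative numbers with sum 1 are each at most 1. The cases for
      \<open>k\<close> and \<open>l\<close> only name which of the six is meant.\<close>
    show "x k l i j \<le> 1"
      using sum[of i j] nonneg[of 1 1 i j] nonneg[of 1 2 i j] nonneg[of 2 1 i j]
        nonneg[of 2 2 i j] nonneg[of 3 1 i j] nonneg[of 3 2 i j]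
        exhaust_3[of k] exhaust_2[of l] by (elim disjE; simp; linarith)
  qed
  \<comment> \<open>The row equation moves the test from the first column to any column
    \<open>j\<close>, so that the value can be read off at the cell (i, j) itself.\<close>
  have row: "row_vec z $ i = (if x 1 1 i j + x 2 1 i j + x 3 1 i j = 1 then 0 else 1)" for i j
  proof -
    have "x 1 1 i first_index + x 2 1 i first_index + x 3 1 i first_index
        = x 1 1 i j + x 2 1 i j + x 3 1 i j"
      using sys by blast
    then show ?thesis
      by (simp add: row_vec_def x_def)
  qed
  \<comment> \<open>Likewise the column equations for k = 1 and k = 2 move both tests to row
    \<open>i\<close>. The default 2 needs no test of its own: by \<open>sum\<close> it is left for a
    1 at k = 3.\<close>
  have col: "col_vec z $ j = (if x 1 1 i j + x 1 2 i j = 1 then 0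
      else if x 2 1 i j + x 2 2 i j = 1 then 1 else 2)" for i j
  proof -
    have "x k 1 first_index j + x k 2 first_index j = x k 1 i j + x k 2 i j" for k
      using sys by blast
    from this[of 1] this[of 2] show ?thesis
      by (simp add: col_vec_def x_def)
  qed
  \<comment> \<open>Everything now depends on one cell. Of the 64 zero-one patterns,
    \<open>sum\<close> refutes all but the six with a single 1, and in each of these the row and
    column values are numerals. With c the column value, (2-c)(1-c)/2, c(2-c) and c(c-1)/2 are the
    Lagrange polynomials at the nodes 0, 1, 2, so they act as indicators of k = 1, 2, 3.\<close>
  have "x 1 1 i j = 1/2 * (1 - row_vec z $ i) * (2 - col_vec z $ j) * (1 - col_vec z $ j) \<and>
      x 1 2 i j = 1/2 * row_vec z $ i * (2 - col_vec z $ j) * (1 - col_vec z $ j) \<and>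
      x 2 1 i j = (1 - row_vec z $ i) * col_vec z $ j * (2 - col_vec z $ j) \<and>
      x 2 2 i j = row_vec z $ i * col_vec z $ j * (2 - col_vec z $ j) \<and>
      x 3 1 i j = 1/2 * (1 - row_vec z $ i) * col_vec z $ j * (col_vec z $ j - 1) \<and>
      x 3 2 i j = 1/2 * row_vec z $ i * col_vec z $ j * (col_vec z $ j - 1)" for i j
    unfolding row[of i j] col[of j i]
    using sum[of i j] zero_one[of 1 1 i j] zero_one[of 1 2 i j] zero_one[of 2 1 i j]
      zero_one[of 2 2 i j] zero_one[of 3 1 i j] zero_one[of 3 2 i j]
    by (elim disjE) simp_all
  moreover have "row_vec z $ i \<in> {0, 1}" for i
    by (simp add: row_vec_def)
  moreover have "col_vec z $ j \<in> {0, 1, 2}" for j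
    by (simp add: col_vec_def)
  ultimately show ?thesis
    unfolding x_def by blast
qed

end
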